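(* There exist an integer $n$ and fuzzy posets $\mathbb{X}_1=\langle X_1;\mu_{X_1}\rangle,\dots,\mathbb{X}_n=\langle X_n;\mu_{X_n}\rangle$ such that $\langle\prod_{i=1}^n X_i;\mu_p\rangle$ is not a fuzzy poset, where $\mu_p((x_1,\dots,x_n),(y_1,\dots,y_n))=\max\left(\sum_{i=1}^n\mu_{X_i}(x_i,y_i)-(n-1),\,0\right)$ (the direct Łukasiewicz product).
   Context: A fuzzy relation on a set $X$ is a map $\mu\colon X\times X\to[0,1]$; it is reflexive if $\mu(x,x)=1$; transitive if $\mu(x,y)>0$ and $\mu(y,z)>0$ imply $\mu(x,z)>0$; anti-symmetric if $\mu(x,y)>0$ and $\mu(y,x)>0$ imply $x=y$. A fuzzy poset is $\langle X;\mu\rangle$ with $\mu$ reflexive, transitive and anti-symmetric. *)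

theory Defs
  imports Complex_Main "HOL-Library.FuncSet"
begin

definition fuzzy_relation :: "'a set \<Rightarrow> ('a \<times> 'a \<Rightarrow> real) \<Rightarrow> bool" where
  "fuzzy_relation X \<mu> \<longleftrightarrow> \<mu> \<in> X \<times> X \<rightarrow> {0..1}"

definition fuzzy_reflexive :: "'a set \<Rightarrow> ('a \<times> 'a \<Rightarrow> real) \<Rightarrow> bool" where
  "fuzzy_reflexive X \<mu> \<longleftrightarrow> (\<forall>x\<in>X. \<mu> (x, x) = 1)"

definition fuzzy_transitive :: "'a set \<Rightarrow> ('a \<times> 'a \<Rightarrow> real) \<Rightarrow> bool" where
  "fuzzy_transitive X \<mu> \<longleftrightarrow>
     (\<forall>x\<in>X. \<forall>y\<in>X. \<forall>z\<in>X. \<mu> (x, y) > 0 \<longrightarrow> \<mu> (y, z) > 0 \<longrightarrow> \<mu> (x, z) > 0)"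

definition fuzzy_antisymmetric :: "'a set \<Rightarrow> ('a \<times> 'a \<Rightarrow> real) \<Rightarrow> bool" where
  "fuzzy_antisymmetric X \<mu> \<longleftrightarrow>
     (\<forall>x\<in>X. \<forall>y\<in>X. \<mu> (x, y) > 0 \<longrightarrow> \<mu> (y, x) > 0 \<longrightarrow> x = y)"

definition fuzzy_poset :: "'a set \<Rightarrow> ('a \<times> 'a \<Rightarrow> real) \<Rightarrow> bool" where
  "fuzzy_poset X \<mu> \<longleftrightarrow>
     fuzzy_relation X \<mu> \<and> fuzzy_reflexive X \<mu> \<and> fuzzy_transitive X \<mu> \<and> fuzzy_antisymmetric X \<mu>"

text \<open>An n-tuple is a function on the index set \<open>{1..n}\<close>, so the product of the carriers is
  the extensional dependent function space \<open>\<Pi>\<^sub>E i\<in>{1..n}. X i\<close>.\<close>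

definition lukasiewicz_product ::
    "nat \<Rightarrow> (nat \<Rightarrow> 'a \<times> 'a \<Rightarrow> real) \<Rightarrow> (nat \<Rightarrow> 'a) \<times> (nat \<Rightarrow> 'a) \<Rightarrow> real" where
  "lukasiewicz_product n \<mu> =
     (\<lambda>(x, y). max ((\<Sum>i=1..n. \<mu> i (x i, y i)) - (real n - 1)) 0)"

end

(* On the chain 0 < 1 < 2, let every comparability have degree 1 except (0, 2), which has degree 1/2.
   In the square of this fuzzy poset the diagonal points satisfy (0,0) < (1,1) < (2,2) with degree 1,
   but the degree of ((0,0), (2,2)) is max (1/2 + 1/2 - 1) 0 = 0, so transitivity fails. *)
theory Submission
  imports Defs
begin

definition chain_relation :: "nat \<times> nat \<Rightarrow> real" where
  "chain_relation = (\<lambda>(x, y). if x = 0 \<and> y = 2 then 1/2 else if x \<le> y then 1 else 0)"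

text \<open>The exceptional degree 1/2 is still positive, so the support is the usual order on
  \<open>nat\<close>; transitivity and antisymmetry depend on the support alone.\<close>

lemma chain_relation_pos_iff: "chain_relation (x, y) > 0 \<longleftrightarrow> x \<le> y"
  by (auto simp: chain_relation_def)

lemma fuzzy_poset_chain_relation: "fuzzy_poset X chain_relation"
  unfolding fuzzy_poset_def fuzzy_relation_def fuzzy_reflexive_def
    fuzzy_transitive_def fuzzy_antisymmetric_def chain_relation_pos_iff
  by (auto simp: chain_relation_def)

lemma not_fuzzy_transitive_chain_square:
  "\<not> fuzzy_transitive (\<Pi>\<^sub>E i\<in>{1..2}. {0..2}) (lukasiewicz_product 2 (\<lambda>_. chain_relation))"
proof
  let ?L = "lukasiewicz_product 2 (\<lambda>_. chain_relation)"
  \<comment> \<open>The diagonal point (k, k), restricted to the index set so that it lies in the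
    extensional product.\<close>
  define c :: "nat \<Rightarrow> nat \<Rightarrow> nat" where "c k = (\<lambda>i\<in>{1..2}. k)" for k
  assume "fuzzy_transitive (\<Pi>\<^sub>E i\<in>{1..2}. {0..2}) ?L"
  moreover have "c k \<in> (\<Pi>\<^sub>E i\<in>{1..2}. {0..2})" if "k \<le> 2" for k
    using that by (auto simp: c_def)
  \<comment> \<open>On the diagonal both summands agree and n - 1 = 1, so degree 1 stays 1 while 1/2
    drops to 0.\<close>
  moreover have L: "?L (c j, c k) = max (2 * chain_relation (j, k) - 1) 0" for j k
    by (simp add: lukasiewicz_product_def c_def)
  moreover have "?L (c 0, c 1) > 0" "?L (c 1, c 2) > 0"
    unfolding L by (simp_all add: chain_relation_def)
  ultimately have "?L (c 0, c 2) > 0"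
    unfolding fuzzy_transitive_def by (meson le_numeral_extra(3) one_le_numeral order_refl zero_le)
  then show False
    unfolding L by (simp add: chain_relation_def)
qed

theorem theorem4p4:
  "\<exists>(n::nat) (X :: nat \<Rightarrow> nat set) (\<mu> :: nat \<Rightarrow> nat \<times> nat \<Rightarrow> real).
     n \<ge> 1 \<and>
     (\<forall>i\<in>{1..n}. fuzzy_poset (X i) (\<mu> i)) \<and>
     \<not> fuzzy_poset (\<Pi>\<^sub>E i\<in>{1..n}. X i) (lukasiewicz_product n \<mu>)"
proof (intro exI conjI ballI)
  \<comment> \<open>The witnesses are left schematic by \<open>exI\<close>; the shown facts fix n =
    2 and constant families.\<close>
  show "(2::nat) \<ge> 1"
    by simp
  show "fuzzy_poset {0..2} chain_relation"
    by (rule fuzzy_poset_chain_relation)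
  show "\<not> fuzzy_poset (\<Pi>\<^sub>E i\<in>{1..2}. {0..2}) (lukasiewicz_product 2 (\<lambda>_. chain_relation))"
    using not_fuzzy_transitive_chain_square by (simp add: fuzzy_poset_def)
qed

end
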